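(* Let $A\in M_2(\mathbb{Z})$ be an expanding matrix whose characteristic polynomial is $x^2+px+q$ with $p\in\mathbb{Z}$ and $|q|=3$, and let $v\in\mathbb{R}^2$ be such that $\{v,Av\}$ is linearly independent. Then $T(A,\mathcal{D})$ is connected for $\mathcal{D}=\{0,v,Av+v\}$ and for $\mathcal{D}=\{0,v,-Av+v\}$.
   Context: A real square matrix is expanding if all its eigenvalues have modulus strictly larger than $1$. For an expanding matrix $A\in M_n(\mathbb{Z})$ and a finite set $\mathcal{D}\subset\mathbb{R}^n$ with $|\mathcal D|=|\det A|$, the self-affine set $T(A,\mathcal{D})$ is the unique nonempty compact set $T$ with $AT=T+\mathcal{D}$; equivalently $T=\{\sum_{i=1}^\infty A^{-i}d_{j_i}: d_{j_i}\in\mathcal{D}\}$. *)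

theory Defs
  imports "HOL-Analysis.Analysis" "HOL-Computational_Algebra.Polynomial"
begin

text \<open>An integer matrix: all entries are integers.\<close>
definition integer_matrix :: "real^'n^'n \<Rightarrow> bool" where
  "integer_matrix A \<longleftrightarrow> (\<forall>i j. A $ i $ j \<in> \<int>)"

text \<open>Eigenvalues of a real square matrix, taken over the complex numbers.\<close>
definition eigenvalue :: "real^'n^'n \<Rightarrow> complex \<Rightarrow> bool" where
  "eigenvalue A z \<longleftrightarrow>
     (\<exists>w::complex^'n. w \<noteq> 0 \<and> map_matrix complex_of_real A *v w = z *s w)"

text \<open>Expanding: all eigenvalues have modulus strictly larger than 1.\<close>
definition expanding :: "real^'n^'n \<Rightarrow> bool" where
  "expanding A \<longleftrightarrow> (\<forall>z. eigenvalue A z \<longrightarrow> norm z > 1)"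

text \<open>Characteristic polynomial det(xI - A) of a 2x2 real matrix.\<close>
definition charpoly2 :: "real^2^2 \<Rightarrow> real poly" where
  "charpoly2 A = [: A$1$1 * A$2$2 - A$1$2 * A$2$1, - (A$1$1 + A$2$2), 1 :]"

text \<open>The self-affine set T(A,D) = { sum_{i>=1} A^{-i} d_i : d_i in D }.\<close>
definition self_affine :: "real^'n^'n \<Rightarrow> (real^'n) set \<Rightarrow> (real^'n) set" where
  "self_affine A D = {x. \<exists>d::nat \<Rightarrow> real^'n. (\<forall>i. d i \<in> D) \<and>
      (\<lambda>i. (((*v) (matrix_inv A)) ^^ Suc i) (d i)) sums x}"

end

theory Submission
  imports Defs
begin

text \<open>
  Connectedness of the self-affine sets \<open>T(A, {0, v, \<plusminus>A v + v})\<close> for expanding \<open>A \<in> M\<^sub>2(\<int>)\<close>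
  with characteristic polynomial \<open>x\<^sup>2 + p x + q\<close>, \<open>|q| = 3\<close>.

  With \<open>L = A\<^sup>-\<^sup>1\<close>, \<open>T(A, D) = {\<Sum>i. L\<^sup>i\<^sup>+\<^sup>1 d\<^sub>i | d\<^sub>i \<in> D}\<close> is the attractor of the maps \<open>x \<mapsto> L (x + d)\<close>.
  The proof has four parts.
  (1) For an arbitrary geometrically contracting linear map \<open>L\<close> on a Euclidean space we show that
      the attractor \<open>T\<close> is a nonempty compact fixed point of the Hutchinson operator, derive the
      classical criterion that \<open>T\<close> is connected for three digits \<open>d\<^sub>0, d\<^sub>1, d\<^sub>2\<close> when the digit
      graph with edges \<open>d - d' \<in> T - T\<close> is connected, and a neighbour criterion: a finite set of
      vectors closed under \<open>s \<mapsto> A s - (D - D)\<close> lies in \<open>T - T\<close>.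
  (2) \<open>A\<^sup>-\<^sup>1\<close> is a geometric contraction: it satisfies \<open>q L\<^sup>2 + p L + 1 = 0\<close>, whose roots are the
      reciprocal eigenvalues, and we solve the resulting linear recurrence coordinatewise.
  (3) Expansiveness leaves only ten pairs \<open>(p, q)\<close>, and \<open>x\<^sup>2 + p x \<plusminus> 3\<close> never has a double root.
  (4) For each pair and each sign an explicit finite neighbour certificate, written in the
      coordinates \<open>a v + b A v\<close> and checked by evaluation, yields the required elements of \<open>T - T\<close>.
\<close>

section \<open>Attractors of contracting linear iterated function systems\<close>

text \<open>\<open>L\<close> is a linear map with \<open>\<parallel>L\<^sup>n x\<parallel> \<le> K r\<^sup>n \<parallel>x\<parallel>\<close> for some \<open>r < 1\<close>.\<close>
locale contracting_linear =
  fixes L :: "'a::euclidean_space \<Rightarrow> 'a" and K r :: real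
  assumes linear_L: "linear L" and r_pos: "0 < r" and r_less_1: "r < 1" and K_nonneg: "0 \<le> K"
    and power_bound: "\<And>n x. norm ((L ^^ n) x) \<le> K * r ^ n * norm x"
begin

text \<open>The attractor of the digit set \<open>D\<close>: all sums \<open>\<Sum>i. L\<^sup>i\<^sup>+\<^sup>1 d\<^sub>i\<close> with digits \<open>d\<^sub>i \<in> D\<close>.\<close>
definition attractor :: "'a set \<Rightarrow> 'a set" where
  "attractor D = {x. \<exists>d. (\<forall>i. d i \<in> D) \<and> (\<lambda>i. (L ^^ Suc i) (d i)) sums x}"

text \<open>The Hutchinson operator of the maps \<open>x \<mapsto> L (x + d)\<close>, \<open>d \<in> D\<close>.\<close>
definition hutchinson :: "'a set \<Rightarrow> 'a set \<Rightarrow> 'a set" where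
  "hutchinson D X = (\<Union>d\<in>D. (\<lambda>x. L (x + d)) ` X)"

text \<open>The difference set \<open>T - T\<close> of the attractor; connectedness is decided by which digit
  differences it contains.\<close>
definition attractor_differences :: "'a set \<Rightarrow> 'a set" where
  "attractor_differences D = {t - t' | t t'. t \<in> attractor D \<and> t' \<in> attractor D}"

lemma bounded_linear_L: "bounded_linear L"
  using linear_L linear_conv_bounded_linear by blast

lemma linear_power: "linear (L ^^ n)"
proof (induction n)
  case 0 then show ?case by (simp add: linear_id[unfolded id_def])
next
  case (Suc n) then show ?case using linear_compose[OF Suc.IH linear_L] by (simp add: o_def)
qed

lemma continuous_on_power: "continuous_on S (L ^^ n)"
  using linear_power linear_continuous_on linear_conv_bounded_linear by blast

lemma continuous_on_digit_map: "continuous_on S (\<lambda>y. L (y + d))"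
proof -
  have eq: "(\<lambda>y. L (y + d)) = (\<lambda>y. L y + L d)" using linear_add[OF linear_L] by auto
  show ?thesis unfolding eq by (intro continuous_intros linear_continuous_on bounded_linear_L)
qed

text \<open>Geometric domination of the terms of a digit series with digits bounded by \<open>M\<close>.\<close>
lemma digit_term_bound:
  assumes "norm y \<le> M" shows "norm ((L ^^ Suc i) y) \<le> K * r ^ Suc i * M"
proof -
  have "norm ((L ^^ Suc i) y) \<le> K * r ^ Suc i * norm y" by (rule power_bound)
  also have "\<dots> \<le> K * r ^ Suc i * M" using assms K_nonneg r_pos by (intro mult_left_mono) auto
  finally show ?thesis .
qed

lemma summable_geometric_bound: "summable (\<lambda>i. K * r ^ Suc i * M)"
proof -
  have "summable (\<lambda>i. r ^ i)" using r_pos r_less_1 by (intro summable_geometric) auto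
  then show ?thesis by (intro summable_mult2 summable_mult) (simp add: summable_Suc_iff)
qed

lemma digit_series_summable:
  assumes "\<And>i. norm (d i) \<le> M"
  shows "summable (\<lambda>i. (L ^^ Suc i) (d i))"
proof (rule summable_norm_cancel, rule summable_comparison_test[OF _ summable_geometric_bound[of M]])
  show "\<exists>N. \<forall>n\<ge>N. norm (norm ((L ^^ Suc n) (d n))) \<le> K * r ^ Suc n * M"
    using digit_term_bound assms by auto
qed

text \<open>Splitting off the first digit: \<open>\<Sum>i. L\<^sup>i\<^sup>+\<^sup>1 d\<^sub>i = L (d\<^sub>0 + \<Sum>i. L\<^sup>i\<^sup>+\<^sup>1 d\<^sub>i\<^sub>+\<^sub>1)\<close>.\<close>
lemma digit_series_shift:
  assumes "(\<lambda>i. (L ^^ Suc i) (d (Suc i))) sums x"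
  shows "(\<lambda>i. (L ^^ Suc i) (d i)) sums L (x + d 0)"
proof -
  define c where "c i = (L ^^ i) (d i)" for i
  have "(\<lambda>i. c (Suc i)) sums x" using assms by (simp add: c_def del: funpow.simps)
  then have "c sums (x + c 0)" by (simp add: sums_Suc_iff)
  then have "(\<lambda>i. L (c i)) sums L (x + c 0)" by (rule bounded_linear.sums[OF bounded_linear_L])
  then show ?thesis by (simp add: c_def)
qed

text \<open>The attractor is the fixed point of the Hutchinson operator: \<open>T = \<Union>d\<in>D. L (T + d)\<close>.\<close>
lemma hutchinson_attractor:
  assumes fin: "finite D" shows "hutchinson D (attractor D) = attractor D"
proof (intro equalityI subsetI)
  fix x assume "x \<in> attractor D"
  then obtain d where dD: "\<forall>i. d i \<in> D" and sx: "(\<lambda>i. (L ^^ Suc i) (d i)) sums x"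
    unfolding attractor_def by blast
  obtain M where M: "\<forall>d\<in>D. norm d \<le> M" using finite_imp_bounded[OF fin] bounded_iff by blast
  have "summable (\<lambda>i. (L ^^ Suc i) (d (Suc i)))" using dD M by (intro digit_series_summable) auto
  then obtain x' where sx': "(\<lambda>i. (L ^^ Suc i) (d (Suc i))) sums x'" using summable_sums by blast
  have "x' \<in> attractor D" unfolding attractor_def using dD sx' by (intro CollectI exI[of _ "\<lambda>i. d (Suc i)"]) simp
  moreover have "x = L (x' + d 0)" using digit_series_shift[OF sx'] sx sums_unique2 by blast
  ultimately show "x \<in> hutchinson D (attractor D)" using dD unfolding hutchinson_def by blast
next
  fix x assume "x \<in> hutchinson D (attractor D)"
  then obtain d0 x' d' where d0: "d0 \<in> D" and x: "x = L (x' + d0)" and dD: "\<forall>i. d' i \<in> D"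
    and sx': "(\<lambda>i. (L ^^ Suc i) (d' i)) sums x'" unfolding hutchinson_def attractor_def by blast
  define d where "d = case_nat d0 d'"
  have "(\<lambda>i. (L ^^ Suc i) (d i)) sums x" using digit_series_shift[of d x'] sx' by (simp add: d_def x)
  moreover have "\<forall>i. d i \<in> D" using dD d0 by (simp add: d_def split: nat.split)
  ultimately show "x \<in> attractor D" unfolding attractor_def by blast
qed

lemma attractor_nonempty:
  assumes "D \<noteq> {}" "finite D" shows "attractor D \<noteq> {}"
proof -
  obtain d0 where d0: "d0 \<in> D" using assms by blast
  have "summable (\<lambda>i. (L ^^ Suc i) d0)" using digit_series_summable[of "\<lambda>_. d0"] by blast
  then show ?thesis unfolding attractor_def using d0 summable_sums by fastforce
qed

text \<open>The attractor is compact: it is the image of the compact digit space \<open>D\<^sup>\<nat>\<close> under the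
  uniformly convergent, hence continuous, digit series.\<close>
lemma attractor_compact:
  assumes fin: "finite D" shows "compact (attractor D)"
proof -
  obtain M where M: "\<forall>d\<in>D. norm d \<le> M" using finite_imp_bounded[OF fin] bounded_iff by blast
  define P where "P = PiE UNIV (\<lambda>_::nat. D)"
  define F where "F d = (\<Sum>i. (L ^^ Suc i) (d i))" for d :: "nat \<Rightarrow> 'a"
  have P: "P = {d. \<forall>i. d i \<in> D}" unfolding P_def PiE_UNIV_domain by auto
  have "compactin (product_topology (\<lambda>i. euclidean) UNIV) P"
    unfolding P_def compactin_PiE using fin finite_imp_compact by auto
  then have "compact P" by (simp add: euclidean_product_topology)
  have "uniform_limit P (\<lambda>n d. \<Sum>i<n. (L ^^ Suc i) (d i)) F sequentially"
    unfolding F_def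
  proof (rule Weierstrass_m_test[OF _ summable_geometric_bound[of M]])
    fix n and d :: "nat \<Rightarrow> 'a" assume "d \<in> P"
    then show "norm ((L ^^ Suc n) (d n)) \<le> K * r ^ Suc n * M" using M P digit_term_bound by auto
  qed
  moreover have "continuous_on P (\<lambda>d. \<Sum>i<n. (L ^^ Suc i) (d i))" for n
  proof (intro continuous_on_sum)
    fix i
    have "continuous_on P (\<lambda>d::nat \<Rightarrow> 'a. d i)"
      by (rule continuous_on_subset[OF continuous_on_product_coordinates]) simp
    then show "continuous_on P (\<lambda>d. (L ^^ Suc i) (d i))"
      using continuous_on_compose[OF _ continuous_on_power] by (simp add: o_def del: funpow.simps)
  qed
  ultimately have "continuous_on P F" by (intro uniform_limit_theorem) auto
  then have "compact (F ` P)" using \<open>compact P\<close> compact_continuous_image by blast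
  moreover have "F ` P = attractor D"
  proof (intro equalityI subsetI)
    fix x assume "x \<in> F ` P"
    then obtain d where d: "\<forall>i. d i \<in> D" and x: "x = F d" using P by auto
    have "summable (\<lambda>i. (L ^^ Suc i) (d i))" using d M by (intro digit_series_summable) auto
    then show "x \<in> attractor D" unfolding attractor_def x F_def using d summable_sums by blast
  next
    fix x assume "x \<in> attractor D"
    then obtain d where d: "\<forall>i. d i \<in> D" and s: "(\<lambda>i. (L ^^ Suc i) (d i)) sums x"
      unfolding attractor_def by blast
    then show "x \<in> F ` P" using P sums_unique unfolding F_def by blast
  qed
  ultimately show ?thesis by simp
qed

lemma hutchinson_mono: "X \<subseteq> Y \<Longrightarrow> hutchinson D X \<subseteq> hutchinson D Y"
  unfolding hutchinson_def by blast

lemma hutchinson_compact: "finite D \<Longrightarrow> compact Y \<Longrightarrow> compact (hutchinson D Y)"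
  unfolding hutchinson_def by (intro compact_UN compact_continuous_image continuous_on_digit_map) auto

text \<open>Invariant sets have invariant convex hulls, since each map \<open>x \<mapsto> L (x + d)\<close> is affine.\<close>
lemma hutchinson_convex_hull:
  assumes "hutchinson D S \<subseteq> S" shows "hutchinson D (convex hull S) \<subseteq> convex hull S"
  unfolding hutchinson_def
proof (intro UN_least)
  fix d assume d: "d \<in> D"
  have "(\<lambda>y. L (y + d)) ` (convex hull S) = L ` ((\<lambda>x. d + x) ` (convex hull S))"
    by (simp add: image_image add.commute)
  also have "\<dots> = L ` (convex hull ((\<lambda>x. d + x) ` S))" by (simp add: convex_hull_translation)
  also have "\<dots> = convex hull (L ` ((\<lambda>x. d + x) ` S))" by (rule convex_hull_linear_image[OF linear_L])
  also have "\<dots> \<subseteq> convex hull S"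
  proof (rule hull_mono)
    show "L ` ((\<lambda>x. d + x) ` S) \<subseteq> S"
    proof
      fix w assume "w \<in> L ` ((\<lambda>x. d + x) ` S)"
      then obtain x where "x \<in> S" "w = L (x + d)" by (auto simp: add.commute)
      then show "w \<in> S" using assms d unfolding hutchinson_def by blast
    qed
  qed
  finally show "(\<lambda>y. L (y + d)) ` (convex hull S) \<subseteq> convex hull S" .
qed

text \<open>Points of the \<open>n\<close>-th iterate of \<open>Y\<close> are shadowed by points of the \<open>n\<close>-th iterate of \<open>Z\<close>,
  up to an error \<open>L\<^sup>n (y - z)\<close>.\<close>
lemma hutchinson_iterate_shadow:
  assumes "Z \<noteq> {}" and "x \<in> (hutchinson D ^^ n) Y"
  shows "\<exists>t\<in>(hutchinson D ^^ n) Z. \<exists>y\<in>Y. \<exists>z\<in>Z. x - t = (L ^^ n) (y - z)"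
  using assms(2)
proof (induction n arbitrary: x)
  case 0
  then show ?case using assms(1) by auto
next
  case (Suc n)
  then obtain d x' where d: "d \<in> D" and x': "x' \<in> (hutchinson D ^^ n) Y" and x: "x = L (x' + d)"
    unfolding hutchinson_def by auto
  obtain t y z where t: "t \<in> (hutchinson D ^^ n) Z" and yz: "y \<in> Y" "z \<in> Z"
    and e: "x' - t = (L ^^ n) (y - z)" using Suc.IH[OF x'] by blast
  have "L (t + d) \<in> (hutchinson D ^^ Suc n) Z" using t d unfolding hutchinson_def by auto
  moreover have "x - L (t + d) = L ((x' + d) - (t + d))" using x linear_diff[OF linear_L] by metis
  then have "x - L (t + d) = (L ^^ Suc n) (y - z)" using e by simp
  ultimately show ?case using yz by blast
qed

text \<open>Iterating the Hutchinson operator on a compact invariant superset of the attractor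
  shrinks it onto the attractor.\<close>
lemma hutchinson_iterates_limit:
  assumes fin: "finite D" and "D \<noteq> {}" and X0: "compact X0" "attractor D \<subseteq> X0"
  shows "(\<Inter>n. (hutchinson D ^^ n) X0) = attractor D"
proof (intro equalityI subsetI)
  let ?T = "attractor D"
  have fix_n: "(hutchinson D ^^ n) ?T = ?T" for n
    by (induction n) (simp_all add: hutchinson_attractor[OF fin])
  have "?T \<subseteq> (hutchinson D ^^ n) X0" for n
  proof (induction n)
    case (Suc n)
    then have "hutchinson D ?T \<subseteq> hutchinson D ((hutchinson D ^^ n) X0)" by (rule hutchinson_mono)
    then show ?case by (simp add: hutchinson_attractor[OF fin])
  qed (use X0(2) in simp)
  then show "x \<in> (\<Inter>n. (hutchinson D ^^ n) X0)" if "x \<in> ?T" for x using that by blast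
  fix x assume x: "x \<in> (\<Inter>n. (hutchinson D ^^ n) X0)"
  have Tne: "?T \<noteq> {}" by (rule attractor_nonempty[OF assms(2) fin])
  obtain R where R: "\<forall>y\<in>X0. norm y \<le> R" using compact_imp_bounded[OF X0(1)] bounded_iff by blast
  obtain t0 where "t0 \<in> X0" using Tne X0(2) by blast
  then have "norm t0 \<le> R" using R by blast
  then have R0: "0 \<le> R" using norm_ge_zero[of t0] by linarith
  have "\<exists>t\<in>?T. dist t x < e" if e: "e > 0" for e
  proof -
    have C: "0 < 2 * K * R + 1" using K_nonneg R0 by (simp add: add_nonneg_pos)
    then have "0 < e / (2 * K * R + 1)" using e by simp
    then obtain n where n: "r ^ n < e / (2 * K * R + 1)" using real_arch_pow_inv[OF _ r_less_1] by blast
    obtain t y z where t: "t \<in> ?T" and yz: "y \<in> X0" "z \<in> ?T" and xt: "x - t = (L ^^ n) (y - z)"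
      using hutchinson_iterate_shadow[OF Tne, where D=D and Y=X0 and n=n and x=x] x fix_n by auto
    have "norm y \<le> R" "norm z \<le> R" using R yz X0(2) by blast+
    then have "norm (y - z) \<le> 2 * R" using norm_triangle_ineq4[of y z] by linarith
    have "dist t x = norm ((L ^^ n) (y - z))" using xt by (metis dist_norm dist_commute)
    also have "\<dots> \<le> K * r ^ n * norm (y - z)" by (rule power_bound)
    also have "\<dots> \<le> K * r ^ n * (2 * R)"
      using \<open>norm (y - z) \<le> 2 * R\<close> K_nonneg r_pos by (intro mult_left_mono) auto
    also have "\<dots> \<le> (2 * K * R + 1) * r ^ n" using r_pos K_nonneg R0 by (simp add: algebra_simps)
    also have "\<dots> < e" using n C by (simp add: pos_less_divide_eq mult.commute)
    finally show ?thesis using t by blast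
  qed
  then show "x \<in> ?T" using closed_approachable[OF compact_imp_closed[OF attractor_compact[OF fin]]] by blast
qed

text \<open>If two of the pieces \<open>L (Y + a)\<close>, \<open>L (Y + b)\<close> both contain the corresponding pieces of the
  attractor, they meet as soon as \<open>b - a \<in> T - T\<close>.\<close>
lemma pieces_meet:
  assumes "b - a \<in> attractor_differences D" and "attractor D \<subseteq> Y"
  shows "(\<lambda>y. L (y + a)) ` Y \<inter> (\<lambda>y. L (y + b)) ` Y \<noteq> {}"
proof -
  obtain t t' where t: "t \<in> Y" "t' \<in> Y" and e: "b - a = t - t'"
    using assms unfolding attractor_differences_def by blast
  then have "L (t + a) = L (t' + b)" using e by (simp add: algebra_simps)
  moreover have "L (t + a) \<in> (\<lambda>y. L (y + a)) ` Y" "L (t' + b) \<in> (\<lambda>y. L (y + b)) ` Y"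
    using t by auto
  ultimately show ?thesis by auto
qed

text \<open>For three digits, the Hutchinson operator preserves connectedness of supersets of the
  attractor if the digit graph with edges \<open>d - d' \<in> T - T\<close> is connected.\<close>
lemma hutchinson_connected:
  assumes D: "D = {d0, d1, d2}" and e1: "d1 - d0 \<in> attractor_differences D"
    and e2: "d2 - d1 \<in> attractor_differences D \<or> d2 - d0 \<in> attractor_differences D"
    and Y: "connected Y" "attractor D \<subseteq> Y"
  shows "connected (hutchinson D Y)"
proof -
  let ?f = "\<lambda>d. (\<lambda>y. L (y + d)) ` Y"
  have c: "connected (?f d)" for d using connected_continuous_image[OF continuous_on_digit_map Y(1)] .
  have "?f d0 \<inter> ?f d1 \<noteq> {}" using pieces_meet[OF e1 Y(2)] .
  then have c01: "connected (?f d0 \<union> ?f d1)" using connected_Un[OF c c] by blast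
  have "(?f d0 \<union> ?f d1) \<inter> ?f d2 \<noteq> {}"
    using e2 pieces_meet[OF _ Y(2), of d2 d1] pieces_meet[OF _ Y(2), of d2 d0] by blast
  then have "connected (?f d0 \<union> ?f d1 \<union> ?f d2)" using connected_Un[OF c01 c] by blast
  moreover have "hutchinson D Y = ?f d0 \<union> ?f d1 \<union> ?f d2" unfolding hutchinson_def D by auto
  ultimately show ?thesis by simp
qed

text \<open>Connectedness criterion for three digits (the attractor is the decreasing intersection of
  the connected compact sets \<open>hutchinson\<^sup>n (convex hull T)\<close>).\<close>
theorem attractor_connected_three_digits:
  assumes D: "D = {d0, d1, d2}" and e1: "d1 - d0 \<in> attractor_differences D"
    and e2: "d2 - d1 \<in> attractor_differences D \<or> d2 - d0 \<in> attractor_differences D"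
  shows "connected (attractor D)"
proof -
  have fin: "finite D" and ne: "D \<noteq> {}" using D by auto
  define X0 where "X0 = convex hull (attractor D)"
  define X where "X n = (hutchinson D ^^ n) X0" for n
  have X0: "compact X0" "attractor D \<subseteq> X0" "hutchinson D X0 \<subseteq> X0"
    unfolding X0_def using hutchinson_convex_hull[of D "attractor D"]
    by (simp_all add: compact_convex_hull attractor_compact[OF fin] hull_subset
        hutchinson_attractor[OF fin])
  have TX: "attractor D \<subseteq> X n" for n
    using hutchinson_iterates_limit[OF fin ne X0(1,2)] unfolding X_def by blast
  have "X (Suc n) \<subseteq> X n" for n
    by (induction n) (use X0(3) hutchinson_mono in \<open>auto simp: X_def\<close>)
  then have nest: "m \<le> n \<Longrightarrow> X n \<subseteq> X m" for m n by (rule lift_Suc_antimono_le)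
  have "compact (X n)" for n
    by (induction n) (simp_all add: X_def X0(1) hutchinson_compact[OF fin])
  moreover have "connected (X n)" for n
  proof (induction n)
    case 0 then show ?case by (simp add: X_def X0_def convex_connected)
  next
    case (Suc n) then show ?case
      using hutchinson_connected[OF D e1 e2 _ TX[of n]] by (simp add: X_def)
  qed
  ultimately have "connected (\<Inter>n. X n)" using connected_nest[of X] nest by blast
  then show ?thesis using hutchinson_iterates_limit[OF fin ne X0(1,2)] by (simp add: X_def)
qed

text \<open>A series of digit differences lies in \<open>T - T\<close>.\<close>
lemma digit_difference_series:
  assumes fin: "finite D" and s: "(\<lambda>i. (L ^^ Suc i) (e i)) sums s"
    and e: "\<And>i. e i \<in> {a - b | a b. a \<in> D \<and> b \<in> D}"
  shows "s \<in> attractor_differences D"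
proof -
  have "\<forall>i. \<exists>ab. fst ab \<in> D \<and> snd ab \<in> D \<and> e i = fst ab - snd ab" using e by fastforce
  then obtain ab where ab: "\<And>i. fst (ab i) \<in> D" "\<And>i. snd (ab i) \<in> D"
    and e_ab: "\<And>i. e i = fst (ab i) - snd (ab i)" by metis
  obtain M where M: "\<forall>d\<in>D. norm d \<le> M" using finite_imp_bounded[OF fin] bounded_iff by blast
  have "summable (\<lambda>i. (L ^^ Suc i) (fst (ab i)))" by (rule digit_series_summable) (use ab M in auto)
  moreover have "summable (\<lambda>i. (L ^^ Suc i) (snd (ab i)))"
    by (rule digit_series_summable) (use ab M in auto)
  ultimately obtain ta tb where ta: "(\<lambda>i. (L ^^ Suc i) (fst (ab i))) sums ta"
    and tb: "(\<lambda>i. (L ^^ Suc i) (snd (ab i))) sums tb" using summable_sums by blast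
  have "(\<lambda>i. (L ^^ Suc i) (e i)) sums (ta - tb)"
    using sums_diff[OF ta tb] by (simp add: e_ab linear_diff[OF linear_power] del: funpow.simps)
  then have "s = ta - tb" using s sums_unique2 by blast
  moreover have "ta \<in> attractor D"
    unfolding attractor_def using ta ab by (intro CollectI exI[of _ "\<lambda>i. fst (ab i)"]) simp
  moreover have "tb \<in> attractor D"
    unfolding attractor_def using tb ab by (intro CollectI exI[of _ "\<lambda>i. snd (ab i)"]) simp
  ultimately show ?thesis unfolding attractor_differences_def by blast
qed

text \<open>Neighbour certificate. Let \<open>E\<close> be a right inverse of \<open>L\<close> (the expanding map). If every
  element \<open>s\<close> of a finite set \<open>S\<close> has a successor \<open>s' \<in> S\<close> with \<open>E s - s' \<in> D - D\<close>, then
  \<open>S \<subseteq> T - T\<close>: following successors expands \<open>s\<close> as a series of digit differences.\<close>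
theorem neighbour_certificate:
  assumes inv: "\<And>y. L (E y) = y" and fin: "finite D" "finite S"
    and succ: "\<forall>s\<in>S. \<exists>s'\<in>S. E s - s' \<in> {a - b | a b. a \<in> D \<and> b \<in> D}"
    and s: "s \<in> S"
  shows "s \<in> attractor_differences D"
proof -
  obtain nx where nx: "\<forall>s\<in>S. nx s \<in> S \<and> E s - nx s \<in> {a - b | a b. a \<in> D \<and> b \<in> D}"
    using bchoice[of S "\<lambda>s s'. s' \<in> S \<and> E s - s' \<in> {a - b | a b. a \<in> D \<and> b \<in> D}"] succ
    by blast
  define z where "z n = (nx ^^ n) s" for n
  have zS: "z n \<in> S" for n by (induction n) (use s nx in \<open>auto simp: z_def\<close>)
  have z_Suc: "z (Suc n) = nx (z n)" for n by (simp add: z_def)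
  \<comment> \<open>The partial sums telescope; \<open>E z\<^sub>n - z\<^sub>n\<^sub>+\<^sub>1\<close> is the \<open>n\<close>-th digit difference.\<close>
  have partial: "(\<Sum>i<n. (L ^^ Suc i) (E (z i) - z (Suc i))) = s - (L ^^ n) (z n)" for n
  proof (induction n)
    case 0 then show ?case by (simp add: z_def)
  next
    case (Suc n)
    have "(L ^^ Suc n) (E (z n) - z (Suc n)) = (L ^^ Suc n) (E (z n)) - (L ^^ Suc n) (z (Suc n))"
      by (rule linear_diff[OF linear_power])
    also have "(L ^^ Suc n) (E (z n)) = (L ^^ n) (z n)" by (simp only: funpow_Suc_right o_def inv)
    finally show ?case using Suc.IH by simp
  qed
  obtain M where M: "\<forall>y\<in>S. norm y \<le> M" using finite_imp_bounded[OF fin(2)] bounded_iff by blast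
  have "(\<lambda>n. (L ^^ n) (z n)) \<longlonglongrightarrow> 0"
  proof (rule Lim_null_comparison)
    show "\<forall>\<^sub>F n in sequentially. norm ((L ^^ n) (z n)) \<le> K * M * r ^ n"
    proof (intro always_eventually allI)
      fix n
      have "norm ((L ^^ n) (z n)) \<le> K * r ^ n * norm (z n)" by (rule power_bound)
      also have "\<dots> \<le> K * r ^ n * M" using M zS[of n] K_nonneg r_pos by (intro mult_left_mono) auto
      finally show "norm ((L ^^ n) (z n)) \<le> K * M * r ^ n" by (simp add: algebra_simps)
    qed
    show "(\<lambda>n. K * M * r ^ n) \<longlonglongrightarrow> 0"
      using tendsto_mult_right_zero[OF LIMSEQ_power_zero[of r], of "K * M"] r_pos r_less_1 by auto
  qed
  then have "(\<lambda>n. s - (L ^^ n) (z n)) \<longlonglongrightarrow> s - 0" by (intro tendsto_intros)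
  then have "(\<lambda>i. (L ^^ Suc i) (E (z i) - z (Suc i))) sums s" unfolding sums_def partial by simp
  moreover have "E (z i) - z (Suc i) \<in> {a - b | a b. a \<in> D \<and> b \<in> D}" for i
    using nx zS[of i] z_Suc by simp
  ultimately show ?thesis by (rule digit_difference_series[OF fin(1)])
qed

end

section \<open>Linear maps annihilated by a quadratic with small reciprocal roots\<close>

text \<open>Closed form of a real sequence satisfying \<open>q s\<^sub>n\<^sub>+\<^sub>2 + p s\<^sub>n\<^sub>+\<^sub>1 + s\<^sub>n = 0\<close> when the polynomial
  \<open>q m\<^sup>2 + p m + 1\<close> has two distinct complex roots \<open>m\<^sub>1, m\<^sub>2\<close>.\<close>
lemma recurrence_closed_form:
  fixes p q :: real and m1 m2 :: complex and s :: "nat \<Rightarrow> real"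
  assumes q: "q \<noteq> 0" and m1: "q * m1^2 + p * m1 + 1 = 0" and m2: "q * m2^2 + p * m2 + 1 = 0"
    and ne: "m1 \<noteq> m2"
    and rec: "\<And>n. q * s (Suc (Suc n)) + p * s (Suc n) + s n = 0"
  shows "complex_of_real (s n) =
    ((s 1 - m2 * s 0) / (m1 - m2)) * m1^n + ((m1 * s 0 - s 1) / (m1 - m2)) * m2^n"
proof -
  define a where "a = (complex_of_real (s 1) - m2 * s 0) / (m1 - m2)"
  define b where "b = (m1 * complex_of_real (s 0) - s 1) / (m1 - m2)"
  have d: "m1 - m2 \<noteq> 0" using ne by simp
  have sq1: "m1^2 = - (p * m1 + 1) / q" and sq2: "m2^2 = - (p * m2 + 1) / q"
    using m1 m2 q by (simp_all add: field_simps eq_neg_iff_add_eq_0 add.commute mult.commute)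
  have "complex_of_real (s n) = a * m1^n + b * m2^n \<and>
        complex_of_real (s (Suc n)) = a * m1^Suc n + b * m2^Suc n" for n
  proof (induction n)
    case 0
    have "a + b = ((complex_of_real (s 1) - m2 * s 0) + (m1 * complex_of_real (s 0) - s 1)) / (m1 - m2)"
      by (simp only: a_def b_def add_divide_distrib)
    also have "\<dots> = complex_of_real (s 0) * (m1 - m2) / (m1 - m2)" by (simp add: algebra_simps)
    finally have "a + b = complex_of_real (s 0)" using d by simp
    have "a * m1 + b * m2 =
        ((complex_of_real (s 1) - m2 * s 0) * m1 + (m1 * complex_of_real (s 0) - s 1) * m2) / (m1 - m2)"
      by (simp only: a_def b_def add_divide_distrib times_divide_eq_left)
    also have "\<dots> = complex_of_real (s 1) * (m1 - m2) / (m1 - m2)" by (simp add: algebra_simps)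
    finally have "a * m1 + b * m2 = complex_of_real (s 1)" using d by simp
    with \<open>a + b = complex_of_real (s 0)\<close> show ?case by simp
  next
    case (Suc n)
    have "s (Suc (Suc n)) = - (p * s (Suc n) + s n) / q" using rec[of n] q by (simp add: field_simps)
    then have "complex_of_real (s (Suc (Suc n))) = - (p * s (Suc n) + s n) / q" by simp
    also have "\<dots> = a * m1^n * m1^2 + b * m2^n * m2^2"
      using Suc.IH q by (simp add: sq1 sq2 field_simps)
    finally show ?case using Suc.IH by (simp add: power2_eq_square algebra_simps)
  qed
  then show ?thesis unfolding a_def b_def by blast
qed

text \<open>Consequently, if both roots lie in the open unit disc, the sequence decays geometrically
  with ratio \<open>max |m\<^sub>1| |m\<^sub>2|\<close>, uniformly in the initial values.\<close>
lemma recurrence_decay: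
  fixes p q :: real and m1 m2 :: complex and s :: "nat \<Rightarrow> real"
  assumes q: "q \<noteq> 0" and m1: "q * m1^2 + p * m1 + 1 = 0" and m2: "q * m2^2 + p * m2 + 1 = 0"
    and ne: "m1 \<noteq> m2" and n1: "norm m1 < 1" and n2: "norm m2 < 1"
    and rec: "\<And>n. q * s (Suc (Suc n)) + p * s (Suc n) + s n = 0"
  shows "\<bar>s n\<bar> \<le> (2 / norm (m1 - m2)) * (\<bar>s 0\<bar> + \<bar>s 1\<bar>) * (max (norm m1) (norm m2))^n"
proof -
  define R where "R = max (norm m1) (norm m2)"
  define c where "c = (\<bar>s 0\<bar> + \<bar>s 1\<bar>) / norm (m1 - m2)"
  define a where "a = (complex_of_real (s 1) - m2 * s 0) / (m1 - m2)"
  define b where "b = (m1 * complex_of_real (s 0) - s 1) / (m1 - m2)"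
  have dd: "norm (m1 - m2) > 0" using ne by simp
  have "norm (complex_of_real (s 1) - m2 * s 0) \<le> \<bar>s 1\<bar> + norm m2 * \<bar>s 0\<bar>"
    using norm_triangle_ineq4[of "complex_of_real (s 1)" "m2 * s 0"] by (simp add: norm_mult)
  also have "\<dots> \<le> \<bar>s 1\<bar> + \<bar>s 0\<bar>" using n2 mult_right_mono[of "norm m2" 1 "\<bar>s 0\<bar>"] by simp
  finally have na: "norm a \<le> c" unfolding a_def c_def using dd by (simp add: norm_divide divide_right_mono)
  have "norm (m1 * complex_of_real (s 0) - s 1) \<le> norm m1 * \<bar>s 0\<bar> + \<bar>s 1\<bar>"
    using norm_triangle_ineq4[of "m1 * complex_of_real (s 0)" "complex_of_real (s 1)"] by (simp add: norm_mult)
  also have "\<dots> \<le> \<bar>s 0\<bar> + \<bar>s 1\<bar>" using n1 mult_right_mono[of "norm m1" 1 "\<bar>s 0\<bar>"] by simp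
  finally have nb: "norm b \<le> c" unfolding b_def c_def using dd by (simp add: norm_divide divide_right_mono)
  have p1: "norm m1 ^ n \<le> R ^ n" and p2: "norm m2 ^ n \<le> R ^ n"
    unfolding R_def by (intro power_mono; simp)+
  have "\<bar>s n\<bar> = norm (a * m1^n + b * m2^n)"
    using recurrence_closed_form[where p=p and q=q and s=s and n=n, OF q m1 m2 ne rec] unfolding a_def b_def by (metis norm_of_real)
  also have "\<dots> \<le> norm a * norm m1 ^ n + norm b * norm m2 ^ n"
    using norm_triangle_ineq[of "a * m1^n" "b * m2^n"] by (simp add: norm_mult norm_power)
  also have "\<dots> \<le> c * R^n + c * R^n"
    using na nb p1 p2 norm_ge_zero[of a] order_trans[OF norm_ge_zero na] by (intro add_mono mult_mono) auto
  finally show ?thesis unfolding R_def c_def by (simp add: field_simps)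
qed

text \<open>If \<open>z\<^sup>2 + p z + q\<close> has two distinct roots outside the closed unit disc, their reciprocals are
  two distinct roots of \<open>q m\<^sup>2 + p m + 1\<close> inside the open unit disc.\<close>
lemma reciprocal_roots:
  fixes p q :: real
  assumes roots: "\<And>z::complex. z^2 + p * z + q = 0 \<Longrightarrow> norm z > 1" and disc: "p^2 - 4*q \<noteq> 0"
  obtains m1 m2 :: complex where "q * m1^2 + p * m1 + 1 = 0" "q * m2^2 + p * m2 + 1 = 0"
    "m1 \<noteq> m2" "0 < norm m1" "norm m1 < 1" "norm m2 < 1"
proof -
  define w where "w = csqrt (of_real (p^2 - 4*q))"
  have w2: "w * w = of_real (p^2 - 4*q)" unfolding w_def by (metis power2_csqrt power2_eq_square)
  have w0: "w \<noteq> 0" unfolding w_def csqrt_eq_0 using disc by (metis of_real_eq_0_iff)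
  define z1 where "z1 = (- of_real p + w) / 2"
  define z2 where "z2 = (- of_real p - w) / 2"
  have r1: "z1^2 + p * z1 + q = 0" and r2: "z2^2 + p * z2 + q = 0"
    unfolding z1_def z2_def by (simp_all add: power2_eq_square field_simps w2)
  have n1: "norm z1 > 1" and n2: "norm z2 > 1" using roots r1 r2 by blast+
  then have z1: "z1 \<noteq> 0" and z2: "z2 \<noteq> 0" by auto
  define m1 where "m1 = 1 / z1"
  define m2 where "m2 = 1 / z2"
  have "q * m1^2 + p * m1 + 1 = (z1^2 + p * z1 + q) / z1^2"
    using z1 by (simp add: m1_def field_simps power2_eq_square)
  then have me1: "q * m1^2 + p * m1 + 1 = 0" using r1 by simp
  have "q * m2^2 + p * m2 + 1 = (z2^2 + p * z2 + q) / z2^2"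
    using z2 by (simp add: m2_def field_simps power2_eq_square)
  then have me2: "q * m2^2 + p * m2 + 1 = 0" using r2 by simp
  have ne: "m1 \<noteq> m2" using w0 z1 z2 by (simp add: m1_def m2_def z1_def z2_def field_simps)
  have nm1: "norm m1 < 1" and nm2: "norm m2 < 1"
    using n1 n2 by (simp_all add: m1_def m2_def norm_divide divide_less_eq_1)
  have "0 < norm m1" using z1 by (simp add: m1_def)
  from that[OF me1 me2 ne this nm1 nm2] show ?thesis .
qed

text \<open>A linear map of \<open>\<real>\<^sup>n\<close> satisfying \<open>q L\<^sup>2 + p L + 1 = 0\<close> is a geometric contraction when
  \<open>z\<^sup>2 + p z + q\<close> has two distinct roots outside the closed unit disc: every coordinate of
  \<open>L\<^sup>n x\<close> obeys the recurrence above, whose roots are the reciprocal roots.\<close>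
lemma quadratic_relation_contracting:
  fixes p q :: real and L :: "real^'n \<Rightarrow> real^'n"
  assumes roots: "\<And>z::complex. z^2 + p * z + q = 0 \<Longrightarrow> norm z > 1"
    and q0: "q \<noteq> 0" and disc: "p^2 - 4*q \<noteq> 0" and lin: "linear L"
    and rel: "\<And>x. q *\<^sub>R L (L x) + p *\<^sub>R L x + x = 0"
  shows "\<exists>K r. contracting_linear L K r"
proof -
  obtain m1 m2 :: complex where me1: "q * m1^2 + p * m1 + 1 = 0" and me2: "q * m2^2 + p * m2 + 1 = 0"
    and ne: "m1 \<noteq> m2" and m1_pos: "0 < norm m1" and nm1: "norm m1 < 1" and nm2: "norm m2 < 1"
    by (rule reciprocal_roots[OF roots disc])
  define R where "R = max (norm m1) (norm m2)"
  define C where "C = 2 / norm (m1 - m2)"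
  have R0: "0 < R" using m1_pos by (simp add: R_def less_max_iff_disj)
  have R1: "R < 1" using nm1 nm2 by (simp add: R_def)
  have C0: "0 \<le> C" by (simp add: C_def)
  obtain CL where CL: "CL > 0" "\<And>x. norm (L x) \<le> norm x * CL"
    using bounded_linear.pos_bounded lin[unfolded linear_conv_bounded_linear] by blast
  have coord: "\<bar>((L ^^ n) x) $ i\<bar> \<le> C * (\<bar>x $ i\<bar> + \<bar>L x $ i\<bar>) * R ^ n" for n x i
  proof -
    define s where "s k = ((L ^^ k) x) $ i" for k
    have "q * s (Suc (Suc k)) + p * s (Suc k) + s k = 0" for k
      using arg_cong[OF rel[of "(L ^^ k) x"], of "\<lambda>y. y $ i"] by (simp add: s_def)
    from recurrence_decay[where p=p and q=q and s=s and n=n, OF q0 me1 me2 ne nm1 nm2 this]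
    show ?thesis by (simp add: s_def C_def R_def)
  qed
  have "norm ((L ^^ n) x) \<le> (CARD('n) * C * (1 + CL)) * R ^ n * norm x" for n x
  proof -
    have "norm ((L ^^ n) x) \<le> (\<Sum>i\<in>UNIV. \<bar>((L ^^ n) x) $ i\<bar>)" by (rule norm_le_l1_cart)
    also have "\<dots> \<le> (\<Sum>i\<in>(UNIV::'n set). C * ((1 + CL) * norm x) * R ^ n)"
    proof (rule sum_mono)
      fix i
      have "\<bar>x $ i\<bar> + \<bar>L x $ i\<bar> \<le> (1 + CL) * norm x"
        using component_le_norm_cart[of x i] component_le_norm_cart[of "L x" i] CL(2)[of x]
        by (simp add: algebra_simps)
      then show "\<bar>((L ^^ n) x) $ i\<bar> \<le> C * ((1 + CL) * norm x) * R ^ n"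
        using coord[of n x i] C0 R0 by (smt (verit) mult_left_mono mult_right_mono zero_le_power)
    qed
    also have "\<dots> = (CARD('n) * C * (1 + CL)) * R ^ n * norm x" by (simp add: algebra_simps)
    finally show ?thesis .
  qed
  moreover have "0 \<le> CARD('n) * C * (1 + CL)" using C0 CL by simp
  ultimately show ?thesis using R0 R1 lin unfolding contracting_linear_def by blast
qed

section \<open>Two-by-two matrices with characteristic polynomial \<open>x\<^sup>2 + p x + q\<close>\<close>

lemma matrix_vector_mult_2: "((A::real^2^2) *v x) $ i = A$i$1 * x$1 + A$i$2 * x$2"
  by (simp add: matrix_vector_mult_def sum_2)

lemma charpoly2_coeffs:
  assumes "charpoly2 A = [: c0, c1, 1 :]"
  shows "A$1$1 * A$2$2 - A$1$2 * A$2$1 = c0" "- (A$1$1 + A$2$2) = c1"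
  using assms unfolding charpoly2_def by simp_all

text \<open>Cayley--Hamilton for \<open>2 \<times> 2\<close> matrices: \<open>A\<^sup>2 + c\<^sub>1 A + c\<^sub>0 = 0\<close>.\<close>
lemma cayley_hamilton2:
  assumes "charpoly2 A = [: c0, c1, 1 :]"
  shows "A *v (A *v x) = (- c1) *\<^sub>R (A *v x) - c0 *\<^sub>R x"
proof -
  note c = charpoly2_coeffs[OF assms]
  have "(A *v (A *v x)) $ i = ((- c1) *\<^sub>R (A *v x) - c0 *\<^sub>R x) $ i" for i
  proof -
    have "(A *v (A *v x)) $ i = A$i$1 * (A$1$1 * x$1 + A$1$2 * x$2) + A$i$2 * (A$2$1 * x$1 + A$2$2 * x$2)"
      by (simp add: matrix_vector_mult_2)
    moreover have "((- c1) *\<^sub>R (A *v x) - c0 *\<^sub>R x) $ i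
       = (A$1$1 + A$2$2) * (A$i$1 * x$1 + A$i$2 * x$2) - (A$1$1 * A$2$2 - A$1$2 * A$2$1) * x$i"
      by (simp add: matrix_vector_mult_2 c(1)[symmetric] c(2)[symmetric] algebra_simps)
    moreover have "i = 1 \<or> i = 2" using exhaust_2 by blast
    ultimately show ?thesis by (auto simp: algebra_simps)
  qed
  then show ?thesis by (simp add: vec_eq_iff)
qed

lemma matrix_inv_cancel:
  fixes A :: "real^'n^'n"
  assumes "det A \<noteq> 0"
  shows "matrix_inv A *v (A *v y) = y" "A *v (matrix_inv A *v y) = y"
proof -
  have "\<exists>A'. A ** A' = mat 1 \<and> A' ** A = mat 1"
    using assms invertible_det_nz unfolding invertible_def by blast
  then have "A ** matrix_inv A = mat 1 \<and> matrix_inv A ** A = mat 1"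
    unfolding matrix_inv_def by (rule someI_ex)
  then show "matrix_inv A *v (A *v y) = y" "A *v (matrix_inv A *v y) = y"
    by (simp_all add: matrix_vector_mul_assoc)
qed

text \<open>Every root of the characteristic polynomial is an eigenvalue; the eigenvector
  \<open>A v - \<mu> v\<close> (\<open>\<mu>\<close> the other root) is nonzero because \<open>v, A v\<close> are independent.\<close>
lemma char_root_eigenvalue:
  fixes A :: "real^2^2"
  assumes ch: "charpoly2 A = [: c0, c1, 1 :]"
    and ind: "independent {v, A *v v}" and ne: "v \<noteq> A *v v"
    and z: "z^2 + c1 * z + c0 = (0::complex)"
  shows "eigenvalue A z"
proof -
  define \<mu> where "\<mu> = - complex_of_real c1 - z"
  define w where "w = (\<chi> i. complex_of_real ((A *v v) $ i) - \<mu> * complex_of_real (v $ i))"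
  have "(map_matrix complex_of_real A *v w) $ i = (z *s w) $ i" for i
  proof -
    have AAv: "A$i$1 * (A *v v)$1 + A$i$2 * (A *v v)$2 = - c1 * (A *v v)$i - c0 * v$i"
      using arg_cong[OF cayley_hamilton2[OF ch, of v], of "\<lambda>y. y $ i"] by (simp add: matrix_vector_mult_2)
    have Av: "A$i$1 * v$1 + A$i$2 * v$2 = (A *v v)$i" by (simp add: matrix_vector_mult_2)
    have zq: "c0 = - c1 * z - z^2" using z by (simp add: algebra_simps eq_neg_iff_add_eq_0)
    have "(map_matrix complex_of_real A *v w) $ i
       = of_real (A$i$1 * (A *v v)$1 + A$i$2 * (A *v v)$2) - \<mu> * of_real (A$i$1 * v$1 + A$i$2 * v$2)"
      by (simp add: w_def matrix_vector_mult_def sum_2 algebra_simps)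
    also have "\<dots> = - c1 * of_real ((A *v v)$i) - c0 * of_real (v$i) - \<mu> * of_real ((A *v v)$i)"
      by (simp only: AAv Av) simp
    also have "\<dots> = (z *s w) $ i" by (simp add: zq w_def \<mu>_def algebra_simps power2_eq_square)
    finally show ?thesis .
  qed
  moreover have "w \<noteq> 0"
  proof
    assume w0: "w = 0"
    have "v \<noteq> 0" using ind dependent_zero by blast
    then obtain i where vi: "v $ i \<noteq> 0" by (auto simp: vec_eq_iff)
    have wi: "complex_of_real ((A *v v) $ j) = \<mu> * complex_of_real (v $ j)" for j
      using arg_cong[OF w0, of "\<lambda>y. y $ j"] by (simp add: w_def)
    define m where "m = (A *v v) $ i / v $ i"
    have "\<mu> = complex_of_real m" using wi[of i] vi by (simp add: m_def field_simps)
    then have "(A *v v) $ j = m * v $ j" for j using wi[of j] by (metis of_real_eq_iff of_real_mult)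
    then have "A *v v = m *\<^sub>R v" by (simp add: vec_eq_iff)
    moreover have "A *v v \<notin> span {v}"
      using ind ne independent_insert[of "A *v v" "{v}"] by (auto simp: insert_commute)
    ultimately show False by (simp add: span_base span_mul)
  qed
  ultimately show ?thesis unfolding eigenvalue_def by (auto simp: vec_eq_iff)
qed

text \<open>The inverse of a \<open>2 \<times> 2\<close> matrix with characteristic polynomial \<open>x\<^sup>2 + c\<^sub>1 x + c\<^sub>0\<close> satisfies
  the reversed relation \<open>c\<^sub>0 L\<^sup>2 + c\<^sub>1 L + 1 = 0\<close>; if \<open>A\<close> is expanding with distinct eigenvalues,
  \<open>L = A\<^sup>-\<^sup>1\<close> is therefore a geometric contraction.\<close>
lemma expanding_inverse_contracting:
  fixes A :: "real^2^2"
  assumes ch: "charpoly2 A = [: c0, c1, 1 :]" and c0: "c0 \<noteq> 0" and disc: "c1^2 - 4*c0 \<noteq> 0"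
    and roots: "\<And>z::complex. z^2 + c1 * z + c0 = 0 \<Longrightarrow> norm z > 1"
  shows "\<exists>K r. contracting_linear (\<lambda>x. matrix_inv A *v x) K r"
proof (rule quadratic_relation_contracting[OF roots c0 disc matrix_vector_mul_linear])
  have "det A \<noteq> 0" using charpoly2_coeffs(1)[OF ch] c0 by (simp add: det_2)
  note cancel = matrix_inv_cancel[OF this]
  fix x
  define y where "y = matrix_inv A *v (matrix_inv A *v x)"
  have "x = A *v (A *v y)" by (simp add: y_def cancel)
  also have "\<dots> = (- c1) *\<^sub>R (matrix_inv A *v x) - c0 *\<^sub>R y"
    by (simp only: cayley_hamilton2[OF ch]) (simp add: y_def cancel)
  finally have eq: "x = (- c1) *\<^sub>R (matrix_inv A *v x) - c0 *\<^sub>R y" .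
  have "c0 *\<^sub>R y + c1 *\<^sub>R (matrix_inv A *v x) + x = x - ((- c1) *\<^sub>R (matrix_inv A *v x) - c0 *\<^sub>R y)"
    by (simp add: algebra_simps)
  also have "\<dots> = 0" unfolding right_minus_eq by (rule eq)
  finally show "c0 *\<^sub>R (matrix_inv A *v (matrix_inv A *v x)) + c1 *\<^sub>R (matrix_inv A *v x) + x = 0"
    by (simp only: y_def)
qed

text \<open>If all roots of \<open>x\<^sup>2 + p x + q\<close>, \<open>|q| = 3\<close>, lie outside the closed unit disc, the polynomial
  has no real root in \<open>[-1, 1]\<close>; by the intermediate value theorem it cannot change sign between
  \<open>-1\<close>, \<open>0\<close> and \<open>1\<close>, which leaves only finitely many \<open>p\<close>.\<close>
lemma expanding_trinomial_cases:
  fixes p q :: int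
  assumes roots: "\<And>z::complex. z^2 + of_int p * z + of_int q = 0 \<Longrightarrow> norm z > 1" and q: "\<bar>q\<bar> = 3"
  shows "(q = 3 \<and> -3 \<le> p \<and> p \<le> 3) \<or> (q = -3 \<and> -1 \<le> p \<and> p \<le> 1)"
proof (rule ccontr)
  assume out: "\<not> ?thesis"
  define f where "f x = x^2 + real_of_int p * x + real_of_int q" for x :: real
  have cont: "continuous_on S f" for S unfolding f_def by (intro continuous_intros)
  have "\<exists>x. -1 \<le> x \<and> x \<le> 1 \<and> f x = 0"
  proof -
    consider "f (-1) \<le> 0" "0 \<le> f 0" | "f 1 \<le> 0" "0 \<le> f 0" | "f 0 \<le> 0" "0 \<le> f 1"
      | "f 0 \<le> 0" "0 \<le> f (-1)"
      using q out unfolding f_def by (cases "q = 3") auto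
    then show ?thesis
    proof cases
      case 1
      then obtain x where "-1 \<le> x" "x \<le> 0" "f x = 0" using IVT'[of f "-1" 0 0, OF _ _ _ cont] by auto
      then show ?thesis by (intro exI[of _ x]) simp
    next
      case 2
      then obtain x where "0 \<le> x" "x \<le> 1" "f x = 0" using IVT2'[of f 1 0 0, OF _ _ _ cont] by auto
      then show ?thesis by (intro exI[of _ x]) simp
    next
      case 3
      then obtain x where "0 \<le> x" "x \<le> 1" "f x = 0" using IVT'[of f 0 0 1, OF _ _ _ cont] by auto
      then show ?thesis by (intro exI[of _ x]) simp
    next
      case 4
      then obtain x where "-1 \<le> x" "x \<le> 0" "f x = 0" using IVT2'[of f 0 0 "-1", OF _ _ _ cont] by auto
      then show ?thesis by (intro exI[of _ x]) simp
    qed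
  qed
  then obtain x where x: "\<bar>x\<bar> \<le> 1" "f x = 0" by (auto simp: abs_le_iff)
  have "(complex_of_real x)^2 + of_int p * complex_of_real x + of_int q = complex_of_real (f x)"
    by (simp add: f_def)
  then have "norm (complex_of_real x) > 1" using x(2) by (intro roots) simp
  then show False using x(1) by simp
qed

section \<open>Neighbour certificates and the main result\<close>

text \<open>Integer coordinates with respect to the basis \<open>v, A v\<close>.\<close>
definition lattice_point :: "real^2^2 \<Rightarrow> real^2 \<Rightarrow> int \<times> int \<Rightarrow> real^2" where
  "lattice_point A v ab = real_of_int (fst ab) *\<^sub>R v + real_of_int (snd ab) *\<^sub>R (A *v v)"

text \<open>In these coordinates \<open>A\<close> acts as the companion matrix of \<open>x\<^sup>2 + p x + q\<close>.\<close>
lemma lattice_point_mult: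
  assumes "charpoly2 A = [: of_int q, of_int p, 1 :]"
  shows "A *v lattice_point A v (a, b) = lattice_point A v (- q * b, a - p * b)"
proof -
  have "A *v lattice_point A v (a, b) = real_of_int a *\<^sub>R (A *v v) + real_of_int b *\<^sub>R (A *v (A *v v))"
    by (simp add: lattice_point_def matrix_vector_right_distrib matrix_vector_mult_scaleR)
  then show ?thesis by (simp add: cayley_hamilton2[OF assms] lattice_point_def algebra_simps)
qed

lemma lattice_point_diff:
  "lattice_point A v (a, b) - lattice_point A v (a', b') = lattice_point A v (a - a', b - b')"
  by (simp add: lattice_point_def algebra_simps)

text \<open>A list \<open>zs\<close> of lattice points is closed under the neighbour step of the digit-difference
  list \<open>ds\<close> if every \<open>z \<in> zs\<close> has some \<open>z' \<in> zs\<close> with \<open>A z - z' \<in> ds\<close> (in coordinates).\<close>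
definition neighbour_closed :: "int \<Rightarrow> int \<Rightarrow> (int \<times> int) list \<Rightarrow> (int \<times> int) list \<Rightarrow> bool" where
  "neighbour_closed p q ds zs \<longleftrightarrow>
     (\<forall>(a, b)\<in>set zs. \<exists>(a', b')\<in>set zs. (- q * b - a', a - p * b - b') \<in> set ds)"

text \<open>Coordinates of the differences \<open>D - D\<close> for \<open>D = {0, v, c A v + v}\<close>.\<close>
definition digit_differences :: "int \<Rightarrow> (int \<times> int) list" where
  "digit_differences c = [(0, 0), (1, 0), (-1, 0), (0, c), (0, -c), (1, c), (-1, -c)]"

text \<open>A certificate for the connectedness of \<open>T(A, {0, v, c A v + v})\<close>: a neighbour-closed list
  that contains the coordinates of \<open>v - 0\<close> and of \<open>(c A v + v) - v\<close> or \<open>(c A v + v) - 0\<close>.\<close>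
definition certificate_ok :: "int \<Rightarrow> int \<Rightarrow> int \<Rightarrow> (int \<times> int) list \<Rightarrow> bool" where
  "certificate_ok p q c zs \<longleftrightarrow> neighbour_closed p q (digit_differences c) zs \<and>
     (1, 0) \<in> set zs \<and> ((0, c) \<in> set zs \<or> (1, c) \<in> set zs)"

lemma digit_differences_sound:
  "lattice_point A v ` set (digit_differences c) \<subseteq>
     {x - y | x y. x \<in> {0, v, of_int c *\<^sub>R (A *v v) + v} \<and> y \<in> {0, v, of_int c *\<^sub>R (A *v v) + v}}"
proof -
  let ?D = "{0, v, of_int c *\<^sub>R (A *v v) + v}"
  have diff: "x - y \<in> {x - y | x y. x \<in> ?D \<and> y \<in> ?D}" if "x \<in> ?D" "y \<in> ?D" for x y
    using that by blast
  show ?thesis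
    using diff[of 0 0] diff[of v 0] diff[of 0 v] diff[of "of_int c *\<^sub>R (A *v v) + v" v]
      diff[of v "of_int c *\<^sub>R (A *v v) + v"] diff[of "of_int c *\<^sub>R (A *v v) + v" 0]
      diff[of 0 "of_int c *\<^sub>R (A *v v) + v"]
    by (simp add: digit_differences_def lattice_point_def algebra_simps)
qed

text \<open>A certificate proves connectedness once \<open>A\<^sup>-\<^sup>1\<close> is contracting: by the neighbour criterion
  its points lie in \<open>T - T\<close>, so the three-digit criterion applies.\<close>
lemma connected_by_certificate:
  fixes A :: "real^2^2" and p q c :: int
  assumes contr: "contracting_linear (\<lambda>x. matrix_inv A *v x) K r"
    and ch: "charpoly2 A = [: of_int q, of_int p, 1 :]" and q0: "q \<noteq> 0"
    and cert: "certificate_ok p q c zs"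
  shows "connected (self_affine A {0, v, of_int c *\<^sub>R (A *v v) + v})"
proof -
  interpret contracting_linear "\<lambda>x. matrix_inv A *v x" K r by (rule contr)
  define D where "D = {0, v, of_int c *\<^sub>R (A *v v) + v}"
  define S where "S = lattice_point A v ` set zs"
  have "det A \<noteq> 0" using charpoly2_coeffs(1)[OF ch] q0 by (simp add: det_2)
  note cancel = matrix_inv_cancel[OF this]
  have step: "\<forall>s\<in>S. \<exists>s'\<in>S. A *v s - s' \<in> {a - b |a b. a \<in> D \<and> b \<in> D}"
  proof
    fix s assume "s \<in> S"
    then obtain a b where "(a, b) \<in> set zs" and s: "s = lattice_point A v (a, b)"
      unfolding S_def by auto
    then obtain a' b' where ab': "(a', b') \<in> set zs"
      and d: "(- q * b - a', a - p * b - b') \<in> set (digit_differences c)"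
      using cert unfolding certificate_ok_def neighbour_closed_def by blast
    have "A *v s - lattice_point A v (a', b') = lattice_point A v (- q * b - a', a - p * b - b')"
      by (simp add: s lattice_point_mult[OF ch] lattice_point_diff)
    also have "\<dots> \<in> {a - b |a b. a \<in> D \<and> b \<in> D}"
      using d digit_differences_sound[of A v c] unfolding D_def by blast
    finally show "\<exists>s'\<in>S. A *v s - s' \<in> {a - b |a b. a \<in> D \<and> b \<in> D}"
      using ab' unfolding S_def by blast
  qed
  have in_diffs: "lattice_point A v t \<in> attractor_differences D" if "t \<in> set zs" for t
    using neighbour_certificate[of "\<lambda>y. A *v y" D S, OF cancel(1) _ _ step] that
    by (simp add: D_def S_def)
  have "v - 0 \<in> attractor_differences D"
    using in_diffs[of "(1, 0)"] cert by (simp add: certificate_ok_def lattice_point_def)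
  moreover have "(of_int c *\<^sub>R (A *v v) + v) - v \<in> attractor_differences D
      \<or> (of_int c *\<^sub>R (A *v v) + v) - 0 \<in> attractor_differences D"
    using in_diffs[of "(0, c)"] in_diffs[of "(1, c)"] cert
    by (auto simp: certificate_ok_def lattice_point_def add.commute)
  ultimately have "connected (attractor D)" by (rule attractor_connected_three_digits[OF D_def])
  moreover have "self_affine A D = attractor D" unfolding self_affine_def attractor_def ..
  ultimately show ?thesis by (simp add: D_def)
qed

text \<open>Certificates for all admissible \<open>(p, q)\<close> and both signs \<open>c = \<plusminus>1\<close>, found by computing the
  neighbour graph; the entry \<open>((p, q, c), zs)\<close> certifies the digit set \<open>{0, v, c A v + v}\<close>.\<close>
definition neighbour_table :: "((int \<times> int \<times> int) \<times> (int \<times> int) list) list" where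
  "neighbour_table = [
    ((-3, 3, 1), [(-5,2),(-4,2),(0,0),(0,1),(1,0)]),
    ((-3, 3, -1), [(1,-1),(1,0),(3,-1)]),
    ((-2, 3, 1), [(-3,1),(-2,0),(0,0),(0,1),(1,-1),(1,0),(2,-1)]),
    ((-2, 3, -1), [(-2,0),(-2,1),(0,-1),(0,1),(1,0),(2,-1),(2,0)]),
    ((-1, 3, 1), [(-2,0),(-2,1),(0,0),(0,1),(1,-1),(1,0),(2,0)]),
    ((-1, 3, -1), [(-2,0),(0,-1),(0,1),(1,0),(2,0)]),
    ((0, 3, 1), [(-2,0),(0,0),(0,1),(1,-1),(1,0),(2,0)]),
    ((0, 3, -1), [(-2,0),(0,-1),(1,0),(1,1),(2,0)]),
    ((1, 3, 1), [(-2,0),(0,-1),(0,0),(0,1),(1,0),(2,0)]),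
    ((1, 3, -1), [(-2,0),(0,-1),(1,0),(2,1)]),
    ((2, 3, 1), [(-2,-1),(0,0),(0,1),(1,0),(2,0)]),
    ((2, 3, -1), [(-2,0),(0,-1),(1,0),(3,1)]),
    ((3, 3, 1), [(-2,-1),(0,0),(1,0),(1,1),(2,1)]),
    ((3, 3, -1), [(-5,-2),(0,-1),(1,0),(4,2),(5,2)]),
    ((-1, -3, 1), [(0,0),(0,1),(1,0),(2,0)]),
    ((-1, -3, -1), [(-3,1),(1,-1),(1,0),(3,-1)]),
    ((0, -3, 1), [(0,0),(0,1),(1,0),(2,0)]),
    ((0, -3, -1), [(-2,0),(0,-1),(1,0)]),
    ((1, -3, 1), [(0,0),(1,0),(1,1),(3,1)]),
    ((1, -3, -1), [(-2,0),(0,-1),(1,0)])]"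

lemma neighbour_table_ok: "\<forall>((p, q, c), zs)\<in>set neighbour_table. certificate_ok p q c zs"
  by code_simp

text \<open>The table covers every admissible pair \<open>(p, q)\<close> (see \<open>expanding_trinomial_cases\<close>).\<close>
lemma neighbour_table_complete:
  "\<forall>p\<in>set [-3..3]. \<forall>q\<in>set [-3, 3]. \<forall>c\<in>set [-1, 1].
     (q = 3 \<or> -1 \<le> p \<and> p \<le> 1) \<longrightarrow> (p, q, c) \<in> set (map fst neighbour_table)"
  by code_simp

lemma certificate_exists:
  assumes "(q = 3 \<and> -3 \<le> p \<and> p \<le> 3) \<or> (q = -3 \<and> -1 \<le> p \<and> p \<le> 1)" and "c = 1 \<or> c = -1"
  shows "\<exists>zs. certificate_ok p q c zs"
proof -
  have "p \<in> set [-3..3]" "q \<in> set [-3, 3]" "c \<in> set [-1, 1]" "q = 3 \<or> -1 \<le> p \<and> p \<le> 1"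
    using assms by auto
  then have "(p, q, c) \<in> set (map fst neighbour_table)" using neighbour_table_complete by blast
  then obtain zs where "((p, q, c), zs) \<in> set neighbour_table" by auto
  then show ?thesis using neighbour_table_ok by auto
qed

text \<open>\<open>x\<^sup>2 + p x \<plusminus> 3\<close> never has a double root, since \<open>12\<close> is not a square.\<close>
lemma trinomial_discriminant_nonzero:
  fixes p q :: int assumes "\<bar>q\<bar> = 3" shows "p^2 \<noteq> 4 * q"
proof
  assume sq: "p^2 = 4 * q"
  have "q = 3 \<or> q = -3" using assms by arith
  then have "p^2 = 12" using sq zero_le_power2[of p] by auto
  moreover have "\<bar>p\<bar> \<le> 3 \<or> 4 \<le> \<bar>p\<bar>" by arith
  then have "p^2 \<le> 9 \<or> 16 \<le> p^2"
    using power_mono[of "\<bar>p\<bar>" 3 2] power_mono[of 4 "\<bar>p\<bar>" 2] by auto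
  ultimately show False by simp
qed

theorem corollary3p5:
  fixes A :: "real^2^2" and p q :: int and v :: "real^2"
  assumes "integer_matrix A"
    and "expanding A"
    and "charpoly2 A = [: of_int q, of_int p, 1 :]"
    and "\<bar>q\<bar> = 3"
    and "independent {v, A *v v}" and "v \<noteq> A *v v"
  shows "connected (self_affine A {0, v, A *v v + v}) \<and>
         connected (self_affine A {0, v, - (A *v v) + v})"
proof -
  have roots: "norm z > 1" if "z^2 + of_int p * z + of_int q = 0" for z :: complex
    using assms(2) char_root_eigenvalue[OF assms(3,5,6), of z] that unfolding expanding_def by simp
  have q0: "real_of_int q \<noteq> 0" using assms(4) by auto
  have disc: "real_of_int p ^ 2 - 4 * real_of_int q \<noteq> 0"
    using trinomial_discriminant_nonzero[OF assms(4), of p] by (simp flip: of_int_power)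
  obtain K r where contr: "contracting_linear (\<lambda>x. matrix_inv A *v x) K r"
    using expanding_inverse_contracting[OF assms(3) q0 disc] roots by auto
  have admissible: "(q = 3 \<and> -3 \<le> p \<and> p \<le> 3) \<or> (q = -3 \<and> -1 \<le> p \<and> p \<le> 1)"
    by (rule expanding_trinomial_cases[OF roots assms(4)])
  obtain zs1 zs2 where "certificate_ok p q 1 zs1" "certificate_ok p q (-1) zs2"
    using certificate_exists[OF admissible] by blast
  then show ?thesis
    using connected_by_certificate[OF contr assms(3), of 1 zs1 v] connected_by_certificate[OF contr assms(3), of "-1" zs2 v] q0
    by simp
qed

end
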